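(* Let $d\in\mathbb{N}$, let $H$ be a finite-dimensional Hilbert space, and let $K:\mathbb{F}_d^+\times\mathbb{F}_d^+\to\mathcal{L}(H)$ be a moment kernel with $K(\emptyset,\emptyset)=I_H$ and $K^{(1)}:=K-\Sigma K\ge0$. Let $K=K_{\mathrm{pure}}+K_{\mathrm{unitary}}$ be the Wold decomposition of $K$, and let $(\mathcal{K},S,W,P)$ be the minimal Cuntz dilation of $K$, with asymptotic projection $P_\infty$. Then the following quantities are equal: $$\begin{aligned}\kappa(K)&=\lim_{N\to\infty}\mathrm{tr}\big((\Sigma^NK)(\emptyset,\emptyset)\big)\\&=\mathrm{tr}\big(K_{\mathrm{unitary}}(\emptyset,\emptyset)\big)\\&=\sup\{\mathrm{tr}(L(\emptyset,\emptyset)):0\le L\le K,\ \Sigma L=L\}\\&=\mathrm{tr}(W^*P_\infty W)\\&=\mathrm{tr}(P_\infty WW^* ).\end{aligned}$$ Furthermore, $$\kappa(K)=0\iff K_{\mathrm{unitary}}=0\iff\Sigma^NK\to0,$$ and $$\kappa(K)=\dim(H)\iff K_{\mathrm{pure}}=0.$$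
   Context: $\mathbb{F}_d^+$ is the free semigroup on $\{1,\dots,d\}$ with neutral element $\emptyset$. For a $d$-tuple of operators $S=(S_1,\dots,S_d)$ and a word $\alpha=i_1\cdots i_k$, $S^\alpha:=S_{i_1}\cdots S_{i_k}$ and $S^\emptyset:=I$. A moment kernel is a kernel $K(\alpha,\beta)=\mathbb{E}[A^\alpha(A^\beta)^*]$, where $A=(A_1,\dots,A_d)$ is a $d$-tuple of strongly measurable random operators $A_i:\Omega\to\mathcal{L}(H)$ over a probability space with $\mathbb{E}[\|A^\alpha\|^2]<\infty$ for all $\alpha\in\mathbb{F}_d^+$. A kernel $K:\mathbb{F}_d^+\times\mathbb{F}_d^+\to\mathcal{L}(H)$ is positive definite, written $K\ge0$, if $\sum_{i,j}\langle u_i,K(\alpha_i,\alpha_j)u_j\rangle\ge0$ for every finite family $\{(\alpha_j,u_j)\}\subset\mathbb{F}_d^+\times H$; $L\le K$ means $K-L\ge0$. In the supremum, $L$ ranges over positive definite $\mathcal{L}(H)$-valued kernels on $\mathbb{F}_d^+\times\mathbb{F}_d^+$. The free shift is $(\Sigma K)(\alpha,\beta):=\sum_{i=1}^dK(\alpha i,\beta i)$. Convergence $\Sigma^NK\to0$ is in the point-weak topology: $\langle u,(\Sigma^NK)(\alpha,\beta)v\rangle\to0$ for all $\alpha,\beta\in\mathbb{F}_d^+$ and $u,v\in H$. Curvature: $\kappa(K):=\lim_{N\to\infty}\mathrm{tr}((\Sigma^NK)(\emptyset,\emptyset))$; the limit exists because the operators $(\Sigma^NK)(\emptyset,\emptyset)$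 are positive and decreasing in $N$. Wold decomposition: $K_{\mathrm{pure}}$ and $K_{\mathrm{unitary}}$ are the unique positive definite kernels with $K=K_{\mathrm{pure}}+K_{\mathrm{unitary}}$, $\Sigma K_{\mathrm{unitary}}=K_{\mathrm{unitary}}$, and $\Sigma^NK_{\mathrm{pure}}\to0$ point-weakly; moreover $K_{\mathrm{unitary}}(\alpha,\beta)=\lim_{N\to\infty}(\Sigma^NK)(\alpha,\beta)$. Minimal Cuntz dilation: put $K^{(0)}:=K$ and $T(X):=\sum_{i=1}^dS_iXS_i^*$. A Cuntz dilation of $K$ consists of a Hilbert space $\mathcal{K}$, a Cuntz family $S=(S_1,\dots,S_d)$ on $\mathcal{K}$ (that is, $S_i^*S_j=\delta_{i,j}I_{\mathcal{K}}$ and $\sum_{i=1}^dS_iS_i^*=I_{\mathcal{K}}$), an isometry $W:H\to\mathcal{K}$, and projections $P=P_0\ge P_1\ge0$ on $\mathcal{K}$ such that, for $n=0,1$, $K^{(n)}(\alpha,\beta)=W^*S^\alpha P_n(S^\beta)^*W$ for all $\alpha,\beta\in\mathbb{F}_d^+$, the projections satisfying the defect recursion on the cyclic subspace $\mathcal{M}:=\overline{\mathrm{span}}\{(S^\gamma)^*Wu:\gamma\in\mathbb{F}_d^+,\ u\in H\}$, namely $T(P_n)\le P_n$ on $\mathcal{M}$ for $n=0,1$, and $P_1=P_0-T(P_0)$. It is minimal if $\mathcal{K}$ is the closed span of $\{S^\alpha P_n(S^\beta)^*Wu:\alpha,\beta\in\mathbb{F}_d^+,\ n\in\{0,1\},\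 u\in H\}$. Asymptotic projection: $P_\infty$ is the positive contraction on $\mathcal{M}$ determined by $\langle y,P_\infty y\rangle=\lim_{N\to\infty}\langle y,T^N(P)y\rangle$ for $y\in\mathcal{M}$ (the range of $W$ lies in $\mathcal{M}$). It satisfies $K_{\mathrm{unitary}}(\alpha,\beta)=W^*S^\alpha P_\infty(S^\beta)^*W$. The name "asymptotic projection" is the paper's; the construction gives $P_\infty$ as a positive contraction. *)

theory Defs
  imports "HOL-Probability.Probability"
begin

section \<open>Complex Hilbert spaces\<close>

text \<open>The inner product is conjugate-linear in the first argument, and the real inner product
  inherited from \<open>real_inner\<close> is its real part, so norm and topology are the usual ones.\<close>

class complex_inner = real_inner +
  fixes scaleC :: "complex \<Rightarrow> 'a \<Rightarrow> 'a"  (infixr "*\<^sub>C" 75)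
    and cinner :: "'a \<Rightarrow> 'a \<Rightarrow> complex"
  assumes scaleR_scaleC: "scaleR r x = complex_of_real r *\<^sub>C x"
    and scaleC_add_right: "c *\<^sub>C (x + y) = c *\<^sub>C x + c *\<^sub>C y"
    and scaleC_add_left: "(b + c) *\<^sub>C x = b *\<^sub>C x + c *\<^sub>C x"
    and scaleC_scaleC: "b *\<^sub>C c *\<^sub>C x = (b * c) *\<^sub>C x"
    and scaleC_one: "1 *\<^sub>C x = x"
    and cinner_commute: "cinner x y = cnj (cinner y x)"
    and cinner_add_right: "cinner x (y + z) = cinner x y + cinner x z"
    and cinner_scaleC_right: "cinner x (c *\<^sub>C y) = c * cinner x y"
    and inner_eq_Re_cinner: "inner x y = Re (cinner x y)"

class chilbert_space = complex_inner + complete_space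

global_interpretation complex_vector:
  vector_space "scaleC :: complex \<Rightarrow> 'a \<Rightarrow> 'a::complex_inner"
  by unfold_locales (simp_all add: scaleC_add_right scaleC_add_left scaleC_scaleC scaleC_one)

definition bounded_clinear :: "('a::complex_inner \<Rightarrow> 'b::complex_inner) \<Rightarrow> bool" where
  "bounded_clinear f \<longleftrightarrow> bounded_linear f \<and> (\<forall>c x. f (c *\<^sub>C x) = c *\<^sub>C f x)"

definition cadjoint :: "('a::complex_inner \<Rightarrow> 'b::complex_inner) \<Rightarrow> 'b \<Rightarrow> 'a" where
  "cadjoint A = (THE B. \<forall>x y. cinner (A x) y = cinner x (B y))"

definition op_le_on :: "'a::complex_inner set \<Rightarrow> ('a \<Rightarrow> 'a) \<Rightarrow> ('a \<Rightarrow> 'a) \<Rightarrow> bool" where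
  "op_le_on V A B \<longleftrightarrow> (\<forall>x\<in>V. cinner x (B x - A x) \<in> \<real>\<^sub>\<ge>\<^sub>0)"

definition is_projection :: "('a::complex_inner \<Rightarrow> 'a) \<Rightarrow> bool" where
  "is_projection P \<longleftrightarrow> bounded_clinear P \<and> P \<circ> P = P \<and> cadjoint P = P"

definition is_isometry :: "('a::complex_inner \<Rightarrow> 'b::complex_inner) \<Rightarrow> bool" where
  "is_isometry W \<longleftrightarrow> bounded_clinear W \<and> (\<forall>u. norm (W u) = norm u)"

definition orthonormal_basis_on :: "'a::complex_inner set \<Rightarrow> 'a set \<Rightarrow> bool" where
  "orthonormal_basis_on V B \<longleftrightarrow>
     (\<forall>x\<in>B. \<forall>y\<in>B. cinner x y = (if x = y then 1 else 0)) \<and>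
     closure (complex_vector.span B) = V"

text \<open>Trace of an operator on the closed subspace \<open>V\<close>. It is only applied to operators of finite
  rank, for which the sum converges and does not depend on the chosen orthonormal basis.\<close>

definition trace_on :: "'a::complex_inner set \<Rightarrow> ('a \<Rightarrow> 'a) \<Rightarrow> complex" where
  "trace_on V A = (\<Sum>\<^sub>\<infinity>e\<in>(SOME B. orthonormal_basis_on V B). cinner e (A e))"

abbreviation tr :: "('a::complex_inner \<Rightarrow> 'a) \<Rightarrow> complex" where
  "tr A \<equiv> trace_on UNIV A"


section \<open>Kernels on the free semigroup\<close>

text \<open>The free semigroup on \<open>d\<close> letters is \<open>'d list\<close> for a finite type \<open>'d\<close> with \<open>d\<close> elements;
  \<open>[]\<close> is the neutral element.\<close>

type_synonym ('d, 'h) kernel = "'d list \<Rightarrow> 'd list \<Rightarrow> 'h \<Rightarrow> 'h"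

definition word_op :: "('d \<Rightarrow> 'h \<Rightarrow> 'h) \<Rightarrow> 'd list \<Rightarrow> 'h \<Rightarrow> 'h" where
  "word_op S \<alpha> = foldr (\<lambda>i X. S i \<circ> X) \<alpha> id"

definition positive_definite :: "('d, 'h::complex_inner) kernel \<Rightarrow> bool" where
  "positive_definite K \<longleftrightarrow> (\<forall>\<alpha> \<beta>. bounded_clinear (K \<alpha> \<beta>)) \<and>
     (\<forall>(n::nat) \<alpha> u. (\<Sum>i<n. \<Sum>j<n. cinner (u i) (K (\<alpha> i) (\<alpha> j) (u j))) \<in> \<real>\<^sub>\<ge>\<^sub>0)"

definition kernel_diff ::
  "('d, 'h::complex_inner) kernel \<Rightarrow> ('d, 'h) kernel \<Rightarrow> ('d, 'h) kernel" where
  "kernel_diff K L = (\<lambda>\<alpha> \<beta> u. K \<alpha> \<beta> u - L \<alpha> \<beta> u)"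

definition kernel_le :: "('d, 'h::complex_inner) kernel \<Rightarrow> ('d, 'h) kernel \<Rightarrow> bool" where
  "kernel_le L K \<longleftrightarrow> positive_definite (kernel_diff K L)"

definition zero_kernel :: "('d, 'h::complex_inner) kernel" where
  "zero_kernel = (\<lambda>\<alpha> \<beta> u. 0)"

definition free_shift :: "('d::finite, 'h::complex_inner) kernel \<Rightarrow> ('d, 'h) kernel" where
  "free_shift K = (\<lambda>\<alpha> \<beta> u. \<Sum>i\<in>UNIV. K (\<alpha> @ [i]) (\<beta> @ [i]) u)"

definition shift_tends_to_zero :: "('d::finite, 'h::complex_inner) kernel \<Rightarrow> bool" where
  "shift_tends_to_zero K \<longleftrightarrow>
     (\<forall>\<alpha> \<beta> u v. (\<lambda>N. cinner u ((free_shift ^^ N) K \<alpha> \<beta> v)) \<longlonglongrightarrow> 0)"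

text \<open>The expectation of an operator-valued random variable is taken weakly.\<close>

definition moment_kernel ::
  "'w measure \<Rightarrow> ('d \<Rightarrow> 'w \<Rightarrow> 'h::chilbert_space \<Rightarrow> 'h) \<Rightarrow> ('d, 'h) kernel \<Rightarrow> bool" where
  "moment_kernel \<Omega> A K \<longleftrightarrow> prob_space \<Omega> \<and>
     (\<forall>i. \<forall>\<omega>\<in>space \<Omega>. bounded_clinear (A i \<omega>)) \<and>
     (\<forall>i u. (\<lambda>\<omega>. A i \<omega> u) \<in> borel_measurable \<Omega>) \<and>
     (\<forall>\<alpha>. integrable \<Omega> (\<lambda>\<omega>. (onorm (word_op (\<lambda>i. A i \<omega>) \<alpha>))\<^sup>2)) \<and>
     (\<forall>\<alpha> \<beta>. bounded_clinear (K \<alpha> \<beta>)) \<and>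
     (\<forall>\<alpha> \<beta> u v. cinner u (K \<alpha> \<beta> v) =
        (\<integral>\<omega>. cinner u (word_op (\<lambda>i. A i \<omega>) \<alpha> (cadjoint (word_op (\<lambda>i. A i \<omega>) \<beta>) v)) \<partial>\<Omega>))"

definition curvature :: "('d::finite, 'h::complex_inner) kernel \<Rightarrow> real" where
  "curvature K = lim (\<lambda>N. Re (tr ((free_shift ^^ N) K [] [])))"

definition wold_decomposition ::
  "('d::finite, 'h::complex_inner) kernel \<Rightarrow> ('d, 'h) kernel \<Rightarrow> ('d, 'h) kernel \<Rightarrow> bool" where
  "wold_decomposition K K_pure K_unitary \<longleftrightarrow>
     positive_definite K_pure \<and> positive_definite K_unitary \<and>
     (\<forall>\<alpha> \<beta> u. K \<alpha> \<beta> u = K_pure \<alpha> \<beta> u + K_unitary \<alpha> \<beta> u) \<and>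
     free_shift K_unitary = K_unitary \<and> shift_tends_to_zero K_pure"


section \<open>Cuntz dilations\<close>

definition cuntz_family :: "('d::finite \<Rightarrow> 'k::chilbert_space \<Rightarrow> 'k) \<Rightarrow> bool" where
  "cuntz_family S \<longleftrightarrow> (\<forall>i. bounded_clinear (S i)) \<and>
     (\<forall>i j x. cadjoint (S i) (S j x) = (if i = j then x else 0)) \<and>
     (\<forall>x. (\<Sum>i\<in>UNIV. S i (cadjoint (S i) x)) = x)"

definition cuntz_map ::
  "('d::finite \<Rightarrow> 'k::chilbert_space \<Rightarrow> 'k) \<Rightarrow> ('k \<Rightarrow> 'k) \<Rightarrow> 'k \<Rightarrow> 'k" where
  "cuntz_map S X = (\<lambda>x. \<Sum>i\<in>UNIV. S i (X (cadjoint (S i) x)))"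

definition cyclic_subspace ::
  "('d \<Rightarrow> 'k::chilbert_space \<Rightarrow> 'k) \<Rightarrow> ('h::chilbert_space \<Rightarrow> 'k) \<Rightarrow> 'k set" where
  "cyclic_subspace S W =
     closure (complex_vector.span {cadjoint (word_op S \<gamma>) (W u) | \<gamma> u. True})"

definition dilates ::
  "('d, 'h::chilbert_space) kernel \<Rightarrow> ('d \<Rightarrow> 'k::chilbert_space \<Rightarrow> 'k) \<Rightarrow>
   ('h \<Rightarrow> 'k) \<Rightarrow> ('k \<Rightarrow> 'k) \<Rightarrow> bool" where
  "dilates K S W P \<longleftrightarrow>
     (\<forall>\<alpha> \<beta> u. K \<alpha> \<beta> u = cadjoint W (word_op S \<alpha> (P (cadjoint (word_op S \<beta>) (W u)))))"

text \<open>The relations between operators on the cyclic subspace, including \<open>P1 = P - T(P)\<close>, are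
  relations between their compressions to that subspace, which need not be invariant under \<open>P\<close>,
  \<open>P1\<close>.\<close>

definition cuntz_dilation ::
  "('d::finite, 'h::chilbert_space) kernel \<Rightarrow> ('d \<Rightarrow> 'k::chilbert_space \<Rightarrow> 'k) \<Rightarrow>
   ('h \<Rightarrow> 'k) \<Rightarrow> ('k \<Rightarrow> 'k) \<Rightarrow> ('k \<Rightarrow> 'k) \<Rightarrow> bool" where
  "cuntz_dilation K S W P P1 \<longleftrightarrow>
     cuntz_family S \<and> is_isometry W \<and> is_projection P \<and> is_projection P1 \<and>
     op_le_on UNIV P1 P \<and>
     dilates K S W P \<and> dilates (kernel_diff K (free_shift K)) S W P1 \<and>
     op_le_on (cyclic_subspace S W) (cuntz_map S P) P \<and>
     op_le_on (cyclic_subspace S W) (cuntz_map S P1) P1 \<and>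
     (\<forall>x\<in>cyclic_subspace S W. \<forall>y\<in>cyclic_subspace S W.
        cinner x (P1 y) = cinner x (P y - cuntz_map S P y))"

definition minimal_cuntz_dilation ::
  "('d::finite, 'h::chilbert_space) kernel \<Rightarrow> ('d \<Rightarrow> 'k::chilbert_space \<Rightarrow> 'k) \<Rightarrow>
   ('h \<Rightarrow> 'k) \<Rightarrow> ('k \<Rightarrow> 'k) \<Rightarrow> ('k \<Rightarrow> 'k) \<Rightarrow> bool" where
  "minimal_cuntz_dilation K S W P P1 \<longleftrightarrow> cuntz_dilation K S W P P1 \<and>
     closure (complex_vector.span
       {word_op S \<alpha> (Q (cadjoint (word_op S \<beta>) (W u))) | \<alpha> \<beta> Q u. Q = P \<or> Q = P1}) = UNIV"

text \<open>An operator on the cyclic subspace is a function on the whole space whose values outside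
  that subspace are irrelevant.\<close>

definition asymptotic_projection ::
  "('d::finite \<Rightarrow> 'k::chilbert_space \<Rightarrow> 'k) \<Rightarrow> ('h::chilbert_space \<Rightarrow> 'k) \<Rightarrow>
   ('k \<Rightarrow> 'k) \<Rightarrow> ('k \<Rightarrow> 'k) \<Rightarrow> bool" where
  "asymptotic_projection S W P P_inf \<longleftrightarrow>
     (let M = cyclic_subspace S W in
       (\<forall>x\<in>M. P_inf x \<in> M) \<and>
       (\<forall>x\<in>M. \<forall>y\<in>M. P_inf (x + y) = P_inf x + P_inf y) \<and>
       (\<forall>c. \<forall>x\<in>M. P_inf (c *\<^sub>C x) = c *\<^sub>C P_inf x) \<and>
       (\<forall>x\<in>M. cinner x (P_inf x) \<in> \<real>\<^sub>\<ge>\<^sub>0) \<and>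
       (\<forall>x\<in>M. norm (P_inf x) \<le> norm x) \<and>
       (\<forall>y\<in>M. (\<lambda>N. cinner y ((cuntz_map S ^^ N) P y)) \<longlonglongrightarrow> cinner y (P_inf y)))"

end

theory Submission imports Defs begin

text \<open>Since \<open>\<Sigma>\<^sup>N K = \<Sigma>\<^sup>N K_pure + K_unitary\<close>, the operators \<open>(\<Sigma>\<^sup>N K)(\<emptyset>, \<emptyset>)\<close> converge weakly to
  \<open>K_unitary(\<emptyset>, \<emptyset>)\<close>, and traces over a finite orthonormal basis converge with them. A positive
  definite \<open>\<Sigma>\<close>-fixed \<open>L \<le> K\<close> satisfies \<open>L = \<Sigma>\<^sup>N L \<le> \<Sigma>\<^sup>N K\<close>, so \<open>K_unitary\<close> attains the supremum. A
  dilation turns \<open>\<Sigma>\<close> into the Cuntz map, so \<open>P_inf\<close> has the quadratic form of \<open>K_unitary(\<emptyset>, \<emptyset>)\<close>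
  on the range of \<open>W\<close>; Parseval's identity in the cyclic subspace gives the second trace. For the
  rigidity statements, \<open>\<Sigma>K \<le> K\<close> propagates \<open>K(\<emptyset>, \<emptyset>) = 0\<close> to all diagonal entries
  \<open>K(\<alpha>, \<alpha>)\<close>, and positive definiteness propagates it to the entries off the diagonal.\<close>

section \<open>Inner product spaces\<close>

lemma cinner_add_left: "cinner (x + y) z = cinner x z + cinner y (z::'a::complex_inner)"
  by (metis cinner_add_right cinner_commute complex_cnj_add)

lemma cinner_scaleC_left: "cinner (c *\<^sub>C x) y = cnj c * cinner x (y::'a::complex_inner)"
  by (metis cinner_commute cinner_scaleC_right complex_cnj_mult)

lemma cinner_self: "cinner x x = complex_of_real ((norm (x::'a::complex_inner))\<^sup>2)"
proof -
  have "Im (cinner x x) = 0"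
    using arg_cong[OF cinner_commute[of x x], of Im] by simp
  then show ?thesis
    using inner_eq_Re_cinner[of x x] by (simp add: complex_eq_iff power2_norm_eq_inner)
qed

lemma norm_scaleC: "norm (c *\<^sub>C x) = cmod c * norm (x::'a::complex_inner)"
proof -
  have "complex_of_real ((norm (c *\<^sub>C x))\<^sup>2) = (c * cnj c) * cinner x x"
    unfolding cinner_self[symmetric] by (simp add: cinner_scaleC_left cinner_scaleC_right)
  also have "\<dots> = complex_of_real ((cmod c * norm x)\<^sup>2)"
    by (simp add: cinner_self complex_norm_square[symmetric] power_mult_distrib)
  finally show ?thesis
    by (metis of_real_eq_iff power2_eq_iff_nonneg norm_ge_zero mult_nonneg_nonneg)
qed

text \<open>A unimodular scalar \<open>c\<close> rotates \<open>y\<close> until its inner product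
  with \<open>x\<close> is real and nonnegative. There the complex and real inner products agree, so
  the real Cauchy-Schwarz inequality applies.\<close>

lemma norm_cinner_le: "cmod (cinner x y) \<le> norm x * norm (y::'a::complex_inner)"
proof (cases "cinner x y = 0")
  case False
  define c where "c = cnj (cinner x y) / cmod (cinner x y)"
  have "cmod c = 1"
    using False by (simp add: c_def norm_divide)
  have "cinner x (c *\<^sub>C y) = cmod (cinner x y)"
    using False complex_norm_square[of "cinner x y"]
    by (simp add: c_def cinner_scaleC_right field_simps power2_eq_square)
  then have "cmod (cinner x y) = inner x (c *\<^sub>C y)"
    by (simp add: inner_eq_Re_cinner)
  also have "\<dots> \<le> norm x * norm y"
    using norm_cauchy_schwarz[of x "c *\<^sub>C y"] \<open>cmod c = 1\<close> by (simp add: norm_scaleC)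
  finally show ?thesis .
qed simp

lemma bounded_bilinear_cinner: "bounded_bilinear (cinner :: 'a::complex_inner \<Rightarrow> _)"
proof
  show "\<exists>K. \<forall>a b::'a. norm (cinner a b) \<le> norm a * norm b * K"
    using norm_cinner_le by (intro exI[of _ 1]) auto
qed (simp_all add: cinner_add_left cinner_add_right cinner_scaleC_left cinner_scaleC_right
       scaleR_scaleC scaleR_conv_of_real)

interpretation cinner: bounded_bilinear "cinner :: 'a::complex_inner \<Rightarrow> 'a \<Rightarrow> complex"
  by (rule bounded_bilinear_cinner)

lemma cinner_ext_right: "(\<And>x::'a::complex_inner. cinner x y = cinner x z) \<Longrightarrow> y = z"
  using cinner_self[of "y - z"] by (simp add: cinner.diff_right)

lemma bounded_linear_scaleC: "bounded_linear ((*\<^sub>C) c :: 'a::complex_inner \<Rightarrow> 'a)"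
proof
  show "\<exists>K. \<forall>x::'a. norm (c *\<^sub>C x) \<le> norm x * K"
    by (intro exI[of _ "cmod c"]) (simp add: norm_scaleC)
qed (simp_all add: scaleC_add_right scaleR_scaleC scaleC_scaleC mult.commute)

section \<open>Complex subspaces and their closures\<close>

lemma complex_subspace_closure:
  assumes "complex_vector.subspace (V::'a::complex_inner set)"
  shows "complex_vector.subspace (closure V)"
proof (rule complex_vector.subspaceI)
  show "0 \<in> closure V"
    using assms closure_subset complex_vector.subspace_0 by blast
next
  fix x y assume "x \<in> closure V" "y \<in> closure V"
  then obtain f g where "\<forall>n. f n \<in> V" "f \<longlonglongrightarrow> x" "\<forall>n. g n \<in> V" "g \<longlonglongrightarrow> y"
    unfolding closure_sequential by blast
  then have "\<forall>n. f n + g n \<in> V" "(\<lambda>n. f n + g n) \<longlonglongrightarrow> x + y"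
    using assms by (auto intro: tendsto_add complex_vector.subspace_add)
  then show "x + y \<in> closure V"
    unfolding closure_sequential by (intro exI[of _ "\<lambda>n. f n + g n"]) simp
next
  fix c x assume "x \<in> closure V"
  then obtain f where "\<forall>n. f n \<in> V" "f \<longlonglongrightarrow> x"
    unfolding closure_sequential by blast
  then have "\<forall>n. c *\<^sub>C f n \<in> V" "(\<lambda>n. c *\<^sub>C f n) \<longlonglongrightarrow> c *\<^sub>C x"
    using assms
    by (auto intro: bounded_linear.tendsto[OF bounded_linear_scaleC] complex_vector.subspace_scale)
  then show "c *\<^sub>C x \<in> closure V"
    unfolding closure_sequential by (intro exI[of _ "\<lambda>n. c *\<^sub>C f n"]) simp
qed

lemma complex_subspace_imp_subspace:
  "complex_vector.subspace (V::'a::complex_inner set) \<Longrightarrow> subspace V"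
  unfolding complex_vector.subspace_def subspace_def by (simp add: scaleR_scaleC)


section \<open>Riesz representation and adjoints\<close>

text \<open>The representing vector minimizes \<open>\<parallel>y\<parallel>\<^sup>2 - 2 f y\<close> over \<open>V\<close>; the parallelogram law makes
  minimizing sequences Cauchy.\<close>

lemma riesz_representation_on:
  fixes V :: "'a::{real_inner,complete_space} set" and f :: "'a \<Rightarrow> real"
  assumes V: "subspace V" "closed V" and f: "bounded_linear f"
  shows "\<exists>z\<in>V. \<forall>y\<in>V. inner z y = f y"
proof -
  interpret f: bounded_linear f by (rule f)
  define q where "q y = (norm y)\<^sup>2 - 2 * f y" for y
  define m where "m = Inf (q ` V)"
  obtain C where C: "\<And>y. norm (f y) \<le> norm y * C"
    using f.bounded by blast
  \<comment> \<open>Completing the square bounds \<open>q\<close> from below, so the infimum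
    \<open>m\<close> is meaningful.\<close>
  have "- C\<^sup>2 \<le> q y" for y
  proof -
    have "0 \<le> (norm y - C)\<^sup>2" by simp
    also have "\<dots> \<le> q y + C\<^sup>2"
      using C[of y] by (simp add: q_def power2_eq_square algebra_simps)
    finally show ?thesis by simp
  qed
  then have bdd: "bdd_below (q ` V)" by (auto intro!: bdd_belowI[of _ "- C\<^sup>2"])
  have ne: "q ` V \<noteq> {}" using subspace_0[OF V(1)] by auto
  have m_le: "m \<le> q y" if "y \<in> V" for y
    unfolding m_def using bdd that by (auto intro: cInf_lower)
  have "\<exists>y\<in>V. q y < m + 1 / real (Suc n)" for n
    using cInf_lessD[OF ne, of "m + 1 / real (Suc n)"] by (auto simp: m_def)
  then obtain s where s: "\<And>n. s n \<in> V" "\<And>n. q (s n) < m + 1 / real (Suc n)"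
    by metis
  \<comment> \<open>The midpoint of \<open>a\<close> and \<open>b\<close> lies in \<open>V\<close>,
    so its \<open>q\<close> value is at least \<open>m\<close>; the linear terms in \<open>f\<close>
    cancel.\<close>
  have parallelogram: "(norm (a - b))\<^sup>2 \<le> 2 * (q a - m) + 2 * (q b - m)"
    if "a \<in> V" "b \<in> V" for a b
  proof -
    have "(1/2) *\<^sub>R (a + b) \<in> V"
      using V(1) that by (intro subspace_scale subspace_add)
    moreover have "(norm (a - b))\<^sup>2 = 2 * q a + 2 * q b - 4 * q ((1/2) *\<^sub>R (a + b))"
      unfolding q_def power2_norm_eq_inner
      by (simp add: f.add f.scaleR inner_add_left inner_add_right inner_diff_left
          inner_diff_right inner_commute algebra_simps)
    ultimately show ?thesis using m_le by fastforce
  qed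
  have "Cauchy s"
  proof (rule metric_CauchyI)
    fix e :: real assume "0 < e"
    \<comment> \<open>Each of the two excesses over \<open>m\<close> enters the parallelogram bound
      with factor 2, so \<open>e\<^sup>2 / 4\<close> for each adds up to
      \<open>e\<^sup>2\<close>.\<close>
    then have "0 < e\<^sup>2 / 4" by simp
    then obtain N where N: "1 / real (Suc N) < e\<^sup>2 / 4"
      using nat_approx_posE by blast
    have close: "q (s n) - m < e\<^sup>2 / 4" if "n \<ge> N" for n
    proof -
      have "1 / real (Suc n) \<le> 1 / real (Suc N)"
        using that by (intro divide_left_mono) auto
      then show ?thesis using s(2)[of n] N by linarith
    qed
    have "dist (s i) (s j) < e" if "i \<ge> N" "j \<ge> N" for i j
    proof -
      have "(norm (s i - s j))\<^sup>2 < e\<^sup>2"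
        using parallelogram[OF s(1) s(1), of i j] close[OF that(1)] close[OF that(2)] by argo
      then show ?thesis
        using \<open>0 < e\<close> by (simp add: dist_norm power2_less_imp_less)
    qed
    then show "\<exists>M. \<forall>i\<ge>M. \<forall>j\<ge>M. dist (s i) (s j) < e" by blast
  qed
  then obtain z where z: "s \<longlonglongrightarrow> z"
    using Cauchy_convergent_iff convergent_def by blast
  have zV: "z \<in> V"
    using V(2) s(1) z closed_sequentially by blast
  have "(\<lambda>n. q (s n)) \<longlonglongrightarrow> q z"
    unfolding q_def by (intro tendsto_intros z f.tendsto)
  moreover have "(\<lambda>n. m + 1 / real (Suc n)) \<longlonglongrightarrow> m + 0"
    using LIMSEQ_inverse_real_of_nat by (intro tendsto_intros) (simp add: inverse_eq_divide)
  ultimately have qz: "q z \<le> m"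
    using LIMSEQ_le[of "\<lambda>n. q (s n)" "q z" "\<lambda>n. m + 1 / real (Suc n)" m] s(2)
    by (auto intro: less_imp_le)
  have "inner z y = f y" if "y \<in> V" for y
  proof (cases "y = 0")
    case False
    \<comment> \<open>This \<open>t\<close> minimizes \<open>q\<close> on the line through
      \<open>z\<close> in direction \<open>y\<close>. Since \<open>z\<close> is already a minimizer,
      the decrease \<open>t * (f y - inner z y)\<close> cannot be positive, although it is a square
      divided by \<open>(norm y)\<^sup>2\<close>.\<close>
    define t where "t = (f y - inner z y) / (norm y)\<^sup>2"
    have "z + t *\<^sub>R y \<in> V"
      using V(1) zV that by (intro subspace_scale subspace_add)
    then have "q z \<le> q (z + t *\<^sub>R y)" using qz m_le by fastforce
    also have "q (z + t *\<^sub>R y) = q z - 2 * t * (f y - inner z y) + t * (t * (norm y)\<^sup>2)"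
      unfolding q_def power2_norm_eq_inner
      by (simp add: f.add f.scaleR inner_add_left inner_add_right inner_commute algebra_simps)
    also have "t * (norm y)\<^sup>2 = f y - inner z y" using False by (simp add: t_def)
    finally have "t * (f y - inner z y) \<le> 0" by simp
    moreover have "t * (f y - inner z y) = (f y - inner z y)\<^sup>2 / (norm y)\<^sup>2"
      by (simp add: t_def power2_eq_square)
    ultimately show ?thesis
      using False by (simp add: divide_le_0_iff)
  qed simp
  with zV show ?thesis by blast
qed

text \<open>A vector is determined by its inner products with all vectors, so the definite
  description in \<open>cadjoint\<close> has at most one solution and any candidate is the
  adjoint.\<close>

lemma cadjoint_eqI:
  assumes "\<And>x y. cinner (A x) y = cinner x (B y)"
  shows "cadjoint A = B"
  unfolding cadjoint_def
proof (rule the_equality)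
  fix C assume "\<forall>x y. cinner (A x) y = cinner x (C y)"
  then have "cinner x (C y) = cinner x (B y)" for x y
    using assms by metis
  then show "C = B"
    using cinner_ext_right by blast
qed (use assms in blast)

text \<open>Real Riesz representation on the whole space supplies a vector matching the real parts;
  this existence, with uniqueness, gives \<open>cadjoint\<close> its defining property.\<close>

lemma cinner_cadjoint:
  fixes A :: "'a::chilbert_space \<Rightarrow> 'b::complex_inner"
  assumes "bounded_clinear A"
  shows "cinner (A x) y = cinner x (cadjoint A y)"
proof -
  have A: "bounded_linear A" "\<And>c x. A (c *\<^sub>C x) = c *\<^sub>C A x"
    using assms by (auto simp: bounded_clinear_def)
  have "\<exists>z. \<forall>x. cinner (A x) y = cinner x z" for y
  proof -
    have "bounded_linear (\<lambda>x. inner y (A x))"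
      by (intro bounded_linear_compose[OF bounded_linear_inner_right A(1)])
    then obtain z where z: "\<And>x. inner z x = inner y (A x)"
      using riesz_representation_on[of UNIV] by auto
    have re: "Re (cinner (A x) y) = Re (cinner x z)" for x
      using z[of x] by (simp add: inner_eq_Re_cinner[symmetric] inner_commute)
    \<comment> \<open>Replacing \<open>x\<close> by \<open>\<i> *\<^sub>C x\<close> turns imaginary
      parts into real parts, so agreement of real parts for all vectors suffices.\<close>
    have "cinner (A x) y = cinner x z" for x
      using re[of x] re[of "\<i> *\<^sub>C x"]
      by (intro complex_eqI) (auto simp: A(2) cinner_scaleC_left)
    then show ?thesis by blast
  qed
  then obtain B where B: "\<And>x y. cinner (A x) y = cinner x (B y)"
    by metis
  then have "cadjoint A = B" by (rule cadjoint_eqI)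
  with B show ?thesis by simp
qed

lemma cadjoint_sum:
  fixes A :: "'a::chilbert_space \<Rightarrow> 'b::complex_inner"
  assumes "bounded_clinear A"
  shows "cadjoint A (\<Sum>i\<in>I. f i) = (\<Sum>i\<in>I. cadjoint A (f i))"
  by (rule cinner_ext_right)
    (simp add: cinner_cadjoint[OF assms, symmetric] cinner.sum_right)

lemma cadjoint_compose:
  fixes A :: "'b::chilbert_space \<Rightarrow> 'c::complex_inner" and B :: "'a::chilbert_space \<Rightarrow> 'b"
  assumes "bounded_clinear A" "bounded_clinear B"
  shows "cadjoint (A \<circ> B) = cadjoint B \<circ> cadjoint A"
  by (rule cadjoint_eqI) (simp add: cinner_cadjoint[OF assms(1)] cinner_cadjoint[OF assms(2)])

lemma cadjoint_id: "cadjoint id = (id :: 'a::complex_inner \<Rightarrow> 'a)"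
  by (rule cadjoint_eqI) simp

lemma bounded_clinear_id: "bounded_clinear id"
  by (simp add: bounded_clinear_def bounded_linear_ident[folded id_def])

lemma bounded_clinear_compose:
  "bounded_clinear A \<Longrightarrow> bounded_clinear B \<Longrightarrow> bounded_clinear (A \<circ> B)"
  unfolding bounded_clinear_def o_def by (auto intro: bounded_linear_compose)

lemma bounded_clinear_sum_apply:
  "bounded_clinear A \<Longrightarrow> A (\<Sum>i\<in>I. f i) = (\<Sum>i\<in>I. A (f i))"
  unfolding bounded_clinear_def by (simp add: bounded_linear.linear linear_sum)


section \<open>Orthonormal bases and traces\<close>

lemma orthonormal_independent:
  assumes "\<forall>x\<in>B. \<forall>y\<in>B. cinner x y = (if x = y then 1 else 0)"
  shows "\<not> complex_vector.dependent (B::'a::complex_inner set)"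
  unfolding complex_vector.independent_explicit_module
proof (intro allI impI)
  fix t u v assume t: "finite t" "t \<subseteq> B" "(\<Sum>w\<in>t. u w *\<^sub>C w) = 0" "v \<in> t"
  have "v \<in> B" using t by blast
  have "0 = cinner v (\<Sum>w\<in>t. u w *\<^sub>C w)" by (simp add: t cinner.zero_right)
  also have "\<dots> = (\<Sum>w\<in>t. if v = w then u w else 0)"
    unfolding cinner.sum_right cinner_scaleC_right
    using bspec[OF bspec[OF assms \<open>v \<in> B\<close>] subsetD[OF t(2)]] by (intro sum.cong) simp_all
  also have "\<dots> = u v" using t by simp
  finally show "u v = 0" by simp
qed

lemma cinner_span_eq_0:
  assumes "y \<in> complex_vector.span B" "\<And>e. e \<in> B \<Longrightarrow> cinner r e = 0"
  shows "cinner r y = 0"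
  using assms(1)
  by (induction rule: complex_vector.span_induct_alt)
    (simp_all add: cinner.zero_right cinner_add_right cinner_scaleC_right assms(2))

text \<open>The Fourier sum \<open>p\<close> is the orthogonal projection of \<open>x\<close> to the
  span: its error is orthogonal to \<open>s - p\<close>, and Pythagoras compares the two
  distances.\<close>

lemma orthonormal_best_approximation:
  assumes B: "\<forall>x\<in>B. \<forall>y\<in>B. cinner x y = (if x = y then 1 else 0)"
    and "finite B" and s: "s \<in> complex_vector.span B"
  shows "norm ((\<Sum>e\<in>B. cinner e x *\<^sub>C e) - x) \<le> norm (s - (x::'a::complex_inner))"
proof -
  define p where "p = (\<Sum>e\<in>B. cinner e x *\<^sub>C e)"
  have "cinner e p = cinner e x" if "e \<in> B" for e
  proof -
    have "cinner e p = (\<Sum>w\<in>B. if e = w then cinner w x else 0)"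
      unfolding p_def cinner.sum_right cinner_scaleC_right
      using bspec[OF bspec[OF B that]] by (intro sum.cong) simp_all
    then show ?thesis using that \<open>finite B\<close> by simp
  qed
  then have orth: "cinner (p - x) e = 0" if "e \<in> B" for e
    using that by (subst cinner_commute) (simp add: cinner.diff_right)
  have "p \<in> complex_vector.span B"
    unfolding p_def
    by (intro complex_vector.span_sum complex_vector.span_scale complex_vector.span_base)
  then have "cinner (p - x) (s - p) = 0"
    using cinner_span_eq_0[OF complex_vector.span_diff[OF s] orth] by blast
  then have orth': "inner (p - x) (s - p) = 0" "inner (s - p) (p - x) = 0"
    by (metis inner_eq_Re_cinner zero_complex.simps(1), metis inner_commute inner_eq_Re_cinner zero_complex.simps(1))
  have "s - x = (p - x) + (s - p)" by simp
  then have "(norm (s - x))\<^sup>2 = (norm (p - x))\<^sup>2 + (norm (s - p))\<^sup>2"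
    unfolding power2_norm_eq_inner by (simp only: inner_add_left inner_add_right orth')
  then have "(norm (p - x))\<^sup>2 \<le> (norm (s - x))\<^sup>2" by simp
  then show ?thesis
    unfolding p_def by (rule power2_le_imp_le) simp
qed

text \<open>Density gives an approximant in the span of some finite \<open>t\<close>. For every
  finite \<open>Y\<close> containing \<open>t\<close>, the Fourier sum over \<open>Y\<close> is at
  least as close to \<open>x\<close>.\<close>

lemma orthonormal_basis_has_sum:
  fixes x :: "'a::complex_inner"
  assumes B: "orthonormal_basis_on V B" and x: "x \<in> V"
  shows "((\<lambda>e. cinner e x *\<^sub>C e) has_sum x) B"
  unfolding has_sum_def tendsto_iff eventually_finite_subsets_at_top
proof (intro allI impI)
  fix \<epsilon> :: real assume "0 < \<epsilon>"
  have "x \<in> closure (complex_vector.span B)"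
    using B x by (simp add: orthonormal_basis_on_def)
  then obtain s where s: "s \<in> complex_vector.span B" "dist s x < \<epsilon>"
    using \<open>0 < \<epsilon>\<close> unfolding closure_approachable by blast
  then obtain t c where t: "finite t" "t \<subseteq> B" and s_eq: "s = (\<Sum>w\<in>t. c w *\<^sub>C w)"
    unfolding complex_vector.span_explicit by blast
  have "s \<in> complex_vector.span t"
    unfolding s_eq
    by (intro complex_vector.span_sum complex_vector.span_scale complex_vector.span_base)
  have "dist (\<Sum>e\<in>Y. cinner e x *\<^sub>C e) x < \<epsilon>" if Y: "finite Y" "t \<subseteq> Y" "Y \<subseteq> B" for Y
  proof -
    have "\<forall>x\<in>Y. \<forall>y\<in>Y. cinner x y = (if x = y then 1 else 0)"
      using B Y(3) unfolding orthonormal_basis_on_def by (meson subsetD)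
    then have "norm ((\<Sum>e\<in>Y. cinner e x *\<^sub>C e) - x) \<le> norm (s - x)"
      using Y(1) \<open>s \<in> complex_vector.span t\<close> complex_vector.span_mono[OF Y(2)]
      by (intro orthonormal_best_approximation) auto
    with s(2) show ?thesis by (simp add: dist_norm)
  qed
  with t show "\<exists>X. finite X \<and> X \<subseteq> B \<and>
      (\<forall>Y. finite Y \<and> X \<subseteq> Y \<and> Y \<subseteq> B \<longrightarrow> dist (\<Sum>e\<in>Y. cinner e x *\<^sub>C e) x < \<epsilon>)"
    by blast
qed

lemma parseval_has_sum:
  fixes x y :: "'a::complex_inner"
  assumes "orthonormal_basis_on V B" "y \<in> V"
  shows "((\<lambda>e. cinner x e * cinner e y) has_sum cinner x y) B"
  using has_sum_bounded_linear[OF cinner.bounded_linear_right[of x] orthonormal_basis_has_sum[OF assms]]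
  by (simp add: o_def cinner_scaleC_right mult.commute)

text \<open>Zorn's lemma yields a maximal orthonormal set \<open>B\<close> in \<open>V\<close>. If
  its closed span missed some \<open>x\<close> in \<open>V\<close>, the normalized component of
  \<open>x\<close> orthogonal to that span would enlarge \<open>B\<close>.\<close>

lemma orthonormal_basis_exists:
  fixes V :: "'a::chilbert_space set"
  assumes V: "complex_vector.subspace V" "closed V"
  shows "\<exists>B. orthonormal_basis_on V B"
proof -
  define orth :: "'a set \<Rightarrow> bool"
    where "orth B \<longleftrightarrow> (\<forall>x\<in>B. \<forall>y\<in>B. cinner x y = (if x = y then 1 else 0))" for B
  define \<A> where "\<A> = {B. B \<subseteq> V \<and> orth B}"
  have "\<exists>M\<in>\<A>. \<forall>X\<in>\<A>. M \<subseteq> X \<longrightarrow> X = M"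
  proof (rule subset_Zorn')
    fix C assume C: "subset.chain \<A> C"
    have C_orth: "X \<subseteq> V" "orth X" if "X \<in> C" for X
      using C that by (auto simp: subset_chain_def \<A>_def)
    have "orth (\<Union>C)"
      unfolding orth_def
    proof (intro ballI)
      fix x y assume "x \<in> \<Union>C" "y \<in> \<Union>C"
      then obtain X Y where XY: "X \<in> C" "x \<in> X" "Y \<in> C" "y \<in> Y" by blast
      then have "X \<subseteq> Y \<or> Y \<subseteq> X" using C by (simp add: subset_chain_def)
      with XY obtain Z where "Z \<in> C" "x \<in> Z" "y \<in> Z" by blast
      then show "cinner x y = (if x = y then 1 else 0)"
        using C_orth(2)[OF \<open>Z \<in> C\<close>] unfolding orth_def by blast
    qed
    moreover have "\<Union>C \<subseteq> V" using C_orth(1) by (rule Union_least)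
    ultimately show "\<Union>C \<in> \<A>" by (simp add: \<A>_def)
  qed
  then obtain B where "B \<in> \<A>" and maximal: "\<forall>X\<in>\<A>. B \<subseteq> X \<longrightarrow> X = B"
    by (elim bexE)
  then have B: "B \<subseteq> V" "orth B" by (simp_all add: \<A>_def)
  define U where "U = closure (complex_vector.span B)"
  have U: "complex_vector.subspace U" "closed U"
    by (simp_all add: U_def complex_subspace_closure)
  have "B \<subseteq> U"
    unfolding U_def by (rule order_trans[OF complex_vector.span_superset closure_subset])
  have "U \<subseteq> V"
    unfolding U_def by (intro closure_minimal complex_vector.span_minimal B V)
  moreover have "x \<in> U" if x: "x \<in> V" for x
  proof (rule ccontr)
    assume "x \<notin> U"
    \<comment> \<open>Representing the functional \<open>inner x\<close> on \<open>U\<close>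
      produces the orthogonal projection of \<open>x\<close> to \<open>U\<close>.\<close>
    obtain z where z: "z \<in> U" "\<And>y. y \<in> U \<Longrightarrow> inner z y = inner x y"
      using riesz_representation_on[OF complex_subspace_imp_subspace[OF U(1)] U(2),
          of "inner x"] bounded_linear_inner_right by blast
    define r where "r = x - z"
    have "r \<noteq> 0" using z(1) \<open>x \<notin> U\<close> by (auto simp: r_def)
    have "r \<in> V"
      using z(1) x \<open>U \<subseteq> V\<close> V(1) by (auto simp: r_def intro: complex_vector.subspace_diff)
    have re: "Re (cinner r y) = 0" if "y \<in> U" for y
      using z(2)[OF that] by (simp add: r_def inner_eq_Re_cinner cinner.diff_left)
    have r0: "cinner r y = 0" if "y \<in> U" for y
      using re[OF that] re[OF complex_vector.subspace_scale[OF U(1) that, of \<i>]]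
      by (intro complex_eqI) (auto simp: cinner_scaleC_right)
    define e where "e = complex_of_real (1 / norm r) *\<^sub>C r"
    have "e \<in> V"
      unfolding e_def by (intro complex_vector.subspace_scale V \<open>r \<in> V\<close>)
    have e0: "cinner e y = 0" if "y \<in> U" for y
      using r0[OF that] by (simp add: e_def cinner_scaleC_left)
    then have e0': "cinner y e = 0" if "y \<in> U" for y
      using that by (subst cinner_commute) simp
    have "norm e = 1"
      using \<open>r \<noteq> 0\<close> by (simp add: e_def norm_scaleC norm_divide)
    then have e1: "cinner e e = 1" by (simp add: cinner_self)
    have "e \<notin> U" using e0[of e] e1 by auto
    have "orth (insert e B)"
      unfolding orth_def
    proof (intro ballI)
      fix x y assume "x \<in> insert e B" "y \<in> insert e B"
      then consider "x = e" "y = e" | "x = e" "y \<in> B" | "x \<in> B" "y = e" | "x \<in> B" "y \<in> B"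
        by blast
      then show "cinner x y = (if x = y then 1 else 0)"
      proof cases
        case 1
        then show ?thesis using e1 by simp
      next
        case 2
        then have "y \<in> U" using \<open>B \<subseteq> U\<close> by blast
        then show ?thesis using 2 e0 \<open>e \<notin> U\<close> by (metis (full_types))
      next
        case 3
        then have "x \<in> U" using \<open>B \<subseteq> U\<close> by blast
        then show ?thesis using 3 e0' \<open>e \<notin> U\<close> by (metis (full_types))
      next
        case 4
        then show ?thesis using B(2) unfolding orth_def by blast
      qed
    qed
    then have "insert e B \<in> \<A>"
      using B(1) \<open>e \<in> V\<close> by (simp add: \<A>_def)
    then have "insert e B = B"
      using maximal by blast
    then have "e \<in> B" by blast
    then show False
      using \<open>e \<notin> U\<close> \<open>B \<subseteq> U\<close> by blast
  qed
  ultimately have "closure (complex_vector.span B) = V" unfolding U_def by blast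
  then have "orthonormal_basis_on V B"
    using B(2) by (simp only: orthonormal_basis_on_def orth_def simp_thms)
  then show ?thesis ..
qed

section \<open>Finite sums and traces in finite dimension\<close>

lemma has_sum_finite_sum:
  fixes f :: "'i \<Rightarrow> 'b \<Rightarrow> 'c::real_normed_vector"
  assumes "finite I" "\<And>i. i \<in> I \<Longrightarrow> (f i has_sum s i) B"
  shows "((\<lambda>x. \<Sum>i\<in>I. f i x) has_sum (\<Sum>i\<in>I. s i)) B"
  using assms by (induction I) (simp_all add: has_sum_add)

lemma orthonormal_expansion:
  assumes "finite E" "orthonormal_basis_on UNIV E"
  shows "(\<Sum>e\<in>E. cinner e x *\<^sub>C e) = x"
  by (rule has_sum_unique[OF has_sum_finite[OF assms(1)]
        orthonormal_basis_has_sum[OF assms(2) UNIV_I]])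

text \<open>\<open>E\<close> is the very basis selected inside \<open>trace_on\<close>, so one
  \<open>E\<close> serves all operators. Independence against a finite spanning set makes it finite,
  and the expansion shows that it spans, which fixes its cardinality.\<close>

lemma finite_dim_trace:
  assumes "\<exists>B :: 'h::chilbert_space set. finite B \<and> complex_vector.span B = UNIV"
  obtains E :: "'h::chilbert_space set" where "finite E" "card E = complex_vector.dim (UNIV :: 'h::chilbert_space set)"
    "orthonormal_basis_on UNIV E" "\<And>A. tr A = (\<Sum>e\<in>E. cinner e (A e))"
proof -
  define E :: "'h set" where "E = (SOME B. orthonormal_basis_on UNIV B)"
  have E: "orthonormal_basis_on UNIV E"
    unfolding E_def by (rule someI_ex[OF orthonormal_basis_exists]) simp_all
  have indep: "\<not> complex_vector.dependent E"
    using E by (intro orthonormal_independent) (simp add: orthonormal_basis_on_def)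
  obtain X :: "'h set" where "finite X" "complex_vector.span X = UNIV"
    using assms by blast
  then have fin: "finite E"
    using complex_vector.independent_span_bound[OF _ indep, of X] by auto
  have "x \<in> complex_vector.span E" for x
  proof -
    have "(\<Sum>e\<in>E. cinner e x *\<^sub>C e) \<in> complex_vector.span E"
      by (intro complex_vector.span_sum complex_vector.span_scale complex_vector.span_base)
    then show ?thesis unfolding orthonormal_expansion[OF fin E] .
  qed
  then have "card E = complex_vector.dim (UNIV :: 'h set)"
    using indep by (intro complex_vector.basis_card_eq_dim) auto
  moreover have "tr A = (\<Sum>e\<in>E. cinner e (A e))" for A
    unfolding trace_on_def E_def[symmetric] using fin by simp
  ultimately show thesis by (rule that[OF fin _ E])
qed

section \<open>Positive definite kernels\<close>

lemma nonneg_Reals_sum: "(\<And>i. i \<in> I \<Longrightarrow> f i \<in> \<real>\<^sub>\<ge>\<^sub>0) \<Longrightarrow> (\<Sum>i\<in>I. f i :: complex) \<in> \<real>\<^sub>\<ge>\<^sub>0"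
  by (induction I rule: infinite_finite_induct) auto

lemma bounded_clinear_sum:
  "(\<And>i. i \<in> I \<Longrightarrow> bounded_clinear (f i)) \<Longrightarrow> bounded_clinear (\<lambda>x. \<Sum>i\<in>I. f i x)"
  unfolding bounded_clinear_def
  by (auto intro: bounded_linear_sum simp: complex_vector.scale_sum_right)

lemma positive_definite_nonneg:
  "positive_definite K \<Longrightarrow> (\<Sum>i<(n::nat). \<Sum>j<n. cinner (u i) (K (\<alpha> i) (\<alpha> j) (u j))) \<in> \<real>\<^sub>\<ge>\<^sub>0"
  by (simp add: positive_definite_def)

lemma positive_definite_diagonal:
  assumes "positive_definite K"
  shows "cinner u (K \<alpha> \<alpha> u) \<in> \<real>\<^sub>\<ge>\<^sub>0"
  using positive_definite_nonneg[OF assms, where n = 1 and u = "\<lambda>_. u" and \<alpha> = "\<lambda>_. \<alpha>"] by simp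

lemma positive_definite_diagonal_real:
  assumes "positive_definite K"
  shows "cinner u (K \<alpha> \<alpha> u) = complex_of_real (Re (cinner u (K \<alpha> \<alpha> u)))"
    and "0 \<le> Re (cinner u (K \<alpha> \<alpha> u))"
  using positive_definite_diagonal[OF assms, of u \<alpha>]
  by (auto simp: complex_nonneg_Reals_iff complex_eq_iff)

lemma affine_nonneg_imp_constant:
  assumes "\<And>t. 0 \<le> a + t * (b::real)"
  shows "b = 0"
proof (rule ccontr)
  assume "b \<noteq> 0"
  then show False using assms[of "- (a + 1) / b"] by simp
qed

text \<open>The equality case of Cauchy-Schwarz for kernels: on the family of \<open>u\<close> at
  \<open>\<alpha>\<close> and \<open>c *\<^sub>C v\<close> at \<open>\<beta>\<close> the quadratic
  term in \<open>c\<close> vanishes, and what remains is nonnegative for every \<open>c\<close> only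
  if the cross terms are zero.\<close>

lemma positive_definite_null_vector:
  assumes K: "positive_definite K" and zero: "cinner v (K \<beta> \<beta> v) = 0"
  shows "K \<alpha> \<beta> v = 0"
proof -
  have lin: "K \<gamma> \<beta> (c *\<^sub>C v) = c *\<^sub>C K \<gamma> \<beta> v" for \<gamma> c
    using K by (simp add: positive_definite_def bounded_clinear_def)
  have "cinner u (K \<alpha> \<beta> v) = 0" for u
  proof -
    define s s' where "s = cinner u (K \<alpha> \<beta> v)" and "s' = cinner v (K \<beta> \<alpha> u)"
    have "(\<Sum>i<2::nat. \<Sum>j<2::nat. cinner (if i = 0 then u else c *\<^sub>C v)
        (K (if i = 0 then \<alpha> else \<beta>) (if j = 0 then \<alpha> else \<beta>) (if j = 0 then u else c *\<^sub>C v))) \<in> \<real>\<^sub>\<ge>\<^sub>0"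
      for c
      by (rule positive_definite_nonneg[OF K])
    then have pos: "cinner u (K \<alpha> \<alpha> u) + (c * s + cnj c * s') \<in> \<real>\<^sub>\<ge>\<^sub>0" for c
      by (simp add: numeral_2_eq_2 zero lin cinner_scaleC_right cinner_scaleC_left s_def s'_def add.assoc)
    have "Im (cinner u (K \<alpha> \<alpha> u)) = 0"
      using positive_definite_diagonal[OF K] by (simp add: complex_nonneg_Reals_iff)
    \<comment> \<open>Reality at \<open>c = 1\<close> and \<open>c = \<i>\<close> says that
      \<open>s'\<close> is the conjugate of \<open>s\<close>. Positivity along the real and
      imaginary axes then removes the two parts of \<open>s\<close>.\<close>
    then have "Im (s + s') = 0" "Re (s - s') = 0"
      using pos[of 1] pos[of \<i>] by (simp_all add: complex_nonneg_Reals_iff)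
    moreover have "Re (s + s') = 0"
    proof (rule affine_nonneg_imp_constant)
      show "0 \<le> Re (cinner u (K \<alpha> \<alpha> u)) + t * Re (s + s')" for t
        using pos[of "complex_of_real t"] by (simp add: complex_nonneg_Reals_iff algebra_simps)
    qed
    moreover have "Im (s' - s) = 0"
    proof (rule affine_nonneg_imp_constant)
      show "0 \<le> Re (cinner u (K \<alpha> \<alpha> u)) + t * Im (s' - s)" for t
        using pos[of "complex_of_real t * \<i>"] by (simp add: complex_nonneg_Reals_iff algebra_simps)
    qed
    ultimately show ?thesis
      unfolding s_def[symmetric] by (simp add: complex_eq_iff)
  qed
  then show ?thesis
    by (intro cinner_ext_right) (simp add: cinner.zero_right)
qed

text \<open>The summands are nonnegative, so each basis vector is null for
  \<open>K \<alpha> \<alpha>\<close>; linearity carries this to every \<open>u\<close> through its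
  expansion in \<open>E\<close>.\<close>

lemma positive_definite_trace_eq_0:
  assumes K: "positive_definite K" and E: "finite E" "orthonormal_basis_on UNIV E"
    and tr0: "(\<Sum>e\<in>E. Re (cinner e (K \<alpha> \<alpha> e))) = 0"
  shows "K \<alpha> \<alpha> u = 0"
proof -
  have "\<forall>e\<in>E. Re (cinner e (K \<alpha> \<alpha> e)) = 0"
    using tr0 E(1) positive_definite_diagonal_real(2)[OF K] by (simp add: sum_nonneg_eq_0_iff)
  then have null: "K \<alpha> \<alpha> e = 0" if "e \<in> E" for e
    using that positive_definite_diagonal_real(1)[OF K, of e \<alpha>]
    by (intro positive_definite_null_vector[OF K]) simp
  have "bounded_clinear (K \<alpha> \<alpha>)"
    using K by (simp add: positive_definite_def)
  then have "K \<alpha> \<alpha> (\<Sum>e\<in>E. cinner e u *\<^sub>C e) = (\<Sum>e\<in>E. cinner e u *\<^sub>C K \<alpha> \<alpha> e)"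
    unfolding bounded_clinear_sum_apply[OF \<open>bounded_clinear (K \<alpha> \<alpha>)\<close>]
    by (simp add: bounded_clinear_def)
  also have "\<dots> = 0" by (simp add: null)
  finally show ?thesis unfolding orthonormal_expansion[OF E] .
qed

section \<open>The free shift on kernels\<close>

lemma free_shift_kernel_diff:
  "free_shift (kernel_diff K L) = kernel_diff (free_shift K) (free_shift L)"
  by (simp add: free_shift_def kernel_diff_def sum_subtractf)

lemma free_shift_funpow_kernel_diff:
  "(free_shift ^^ N) (kernel_diff K L) = kernel_diff ((free_shift ^^ N) K) ((free_shift ^^ N) L)"
  by (induction N) (simp_all add: free_shift_kernel_diff)

lemma funpow_fixed: "f x = x \<Longrightarrow> (f ^^ N) x = x"
  by (induction N) simp_all

text \<open>Each letter \<open>k\<close> contributes the form of \<open>K\<close> at the same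
  vectors with all words lengthened by \<open>k\<close>. With linearity of the shift this makes the
  shift monotone for \<open>kernel_le\<close>.\<close>

lemma positive_definite_free_shift:
  assumes "positive_definite K"
  shows "positive_definite (free_shift K)"
  unfolding positive_definite_def
proof (intro conjI allI)
  show "bounded_clinear (free_shift K \<alpha> \<beta>)" for \<alpha> \<beta>
    using assms unfolding free_shift_def positive_definite_def
    by (intro bounded_clinear_sum) simp
  fix n and \<alpha> :: "nat \<Rightarrow> 'a list" and u :: "nat \<Rightarrow> 'b"
  have "(\<Sum>i<n. \<Sum>j<n. cinner (u i) (free_shift K (\<alpha> i) (\<alpha> j) (u j))) =
      (\<Sum>i<n. \<Sum>k\<in>UNIV. \<Sum>j<n. cinner (u i) (K (\<alpha> i @ [k]) (\<alpha> j @ [k]) (u j)))"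
    unfolding free_shift_def cinner.sum_right by (intro sum.cong refl sum.swap)
  also have "\<dots> = (\<Sum>k\<in>UNIV. \<Sum>i<n. \<Sum>j<n. cinner (u i) (K (\<alpha> i @ [k]) (\<alpha> j @ [k]) (u j)))"
    by (rule sum.swap)
  also have "\<dots> \<in> \<real>\<^sub>\<ge>\<^sub>0"
    by (intro nonneg_Reals_sum positive_definite_nonneg[OF assms])
  finally show "(\<Sum>i<n. \<Sum>j<n. cinner (u i) (free_shift K (\<alpha> i) (\<alpha> j) (u j))) \<in> \<real>\<^sub>\<ge>\<^sub>0" .
qed

lemma positive_definite_free_shift_funpow:
  "positive_definite K \<Longrightarrow> positive_definite ((free_shift ^^ N) K)"
  by (induction N) (simp_all add: positive_definite_free_shift)

lemma positive_definite_zero: "positive_definite zero_kernel"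
  unfolding positive_definite_def zero_kernel_def bounded_clinear_def
  by (simp add: cinner.zero_right)

text \<open>Serves both rigidity statements: \<open>K_unitary\<close> has zero defect, and
  \<open>K_pure\<close> has the same defect as the full kernel.\<close>

lemma superharmonic_kernel_eq_zero:
  fixes K :: "('d::finite, 'h::complex_inner) kernel"
  assumes K: "positive_definite K" "positive_definite (kernel_diff K (free_shift K))"
    and zero: "\<And>u. cinner u (K [] [] u) = 0"
  shows "K = zero_kernel"
proof -
  have diag: "cinner u (K \<alpha> \<alpha> u) = 0" for \<alpha> u
  \<comment> \<open>Letters are appended on the right, where \<open>free_shift\<close> acts. The
    entry at a word dominates the sum of the nonnegative entries at its one-letter
    extensions.\<close>
  proof (induction \<alpha> arbitrary: u rule: rev_induct)
    case (snoc i \<alpha>)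
    have "0 \<le> Re (cinner u (K \<alpha> \<alpha> u) - (\<Sum>k\<in>UNIV. cinner u (K (\<alpha> @ [k]) (\<alpha> @ [k]) u)))"
      using positive_definite_diagonal_real(2)[OF K(2), of u \<alpha>]
      by (simp add: kernel_diff_def free_shift_def cinner.diff_right cinner.sum_right)
    then have "(\<Sum>k\<in>UNIV. Re (cinner u (K (\<alpha> @ [k]) (\<alpha> @ [k]) u))) \<le> 0"
      using snoc by simp
    moreover have "Re (cinner u (K (\<alpha> @ [i]) (\<alpha> @ [i]) u)) \<le>
        (\<Sum>k\<in>UNIV. Re (cinner u (K (\<alpha> @ [k]) (\<alpha> @ [k]) u)))"
      by (rule member_le_sum) (simp_all add: positive_definite_diagonal_real(2)[OF K(1)])
    ultimately have "Re (cinner u (K (\<alpha> @ [i]) (\<alpha> @ [i]) u)) = 0"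
      using positive_definite_diagonal_real(2)[OF K(1), of u "\<alpha> @ [i]"] by linarith
    then show ?case
      using positive_definite_diagonal_real(1)[OF K(1), of u "\<alpha> @ [i]"] by simp
  qed (rule zero)
  show ?thesis
    unfolding zero_kernel_def
    by (intro ext positive_definite_null_vector[OF K(1)] diag)
qed


section \<open>Dilations\<close>

lemma word_op_Nil: "word_op S [] = id"
  by (simp add: word_op_def)

lemma word_op_snoc: "word_op S (\<alpha> @ [i]) = word_op S \<alpha> \<circ> S i"
  by (induction \<alpha>) (simp_all add: word_op_def o_assoc)

lemma bounded_clinear_word_op:
  "(\<And>i. bounded_clinear (S i)) \<Longrightarrow> bounded_clinear (word_op S \<alpha>)"
  by (induction \<alpha>)
    (simp_all add: word_op_def bounded_clinear_id bounded_clinear_compose)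

text \<open>A letter appended on the right becomes the innermost factor of the word operator, next
  to \<open>P\<close>; summing over letters assembles \<open>cuntz_map S P\<close>.\<close>

lemma dilates_free_shift:
  fixes S :: "'d::finite \<Rightarrow> 'k::chilbert_space \<Rightarrow> 'k"
  assumes K: "dilates K S W P" and S: "\<And>i. bounded_clinear (S i)" and W: "bounded_clinear W"
  shows "dilates (free_shift K) S W (cuntz_map S P)"
  unfolding dilates_def
proof (intro allI)
  fix \<alpha> \<beta> u
  have "free_shift K \<alpha> \<beta> u = (\<Sum>i\<in>UNIV. cadjoint W (word_op S \<alpha>
      (S i (P (cadjoint (S i) (cadjoint (word_op S \<beta>) (W u)))))))"
    using K unfolding free_shift_def dilates_def
    by (simp add: word_op_snoc cadjoint_compose[OF bounded_clinear_word_op[OF S] S])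
  also have "\<dots> = cadjoint W (word_op S \<alpha> (cuntz_map S P (cadjoint (word_op S \<beta>) (W u))))"
    unfolding cuntz_map_def
    by (simp add: cadjoint_sum[OF W] bounded_clinear_sum_apply[OF bounded_clinear_word_op[OF S]])
  finally show "free_shift K \<alpha> \<beta> u =
    cadjoint W (word_op S \<alpha> (cuntz_map S P (cadjoint (word_op S \<beta>) (W u))))" .
qed

text \<open>Since \<open>dilates\<close> accepts any operator in place of the projection, the
  one-step lemma iterates.\<close>

lemma dilates_free_shift_funpow:
  fixes S :: "'d::finite \<Rightarrow> 'k::chilbert_space \<Rightarrow> 'k"
  assumes "dilates K S W P" "\<And>i. bounded_clinear (S i)" "bounded_clinear W"
  shows "dilates ((free_shift ^^ N) K) S W ((cuntz_map S ^^ N) P)"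
  by (induction N) (simp_all add: assms dilates_free_shift)

lemma range_in_cyclic_subspace: "W u \<in> cyclic_subspace S W"
proof -
  have "W u = cadjoint (word_op S []) (W u)"
    by (simp add: word_op_Nil cadjoint_id)
  then have "W u \<in> {cadjoint (word_op S \<gamma>) (W u) | \<gamma> u. True}" by blast
  then show ?thesis
    unfolding cyclic_subspace_def
    by (intro subsetD[OF closure_subset] complex_vector.span_base)
qed

lemma complex_subspace_cyclic_subspace: "complex_vector.subspace (cyclic_subspace S W)"
  unfolding cyclic_subspace_def
  by (intro complex_subspace_closure complex_vector.subspace_span)

text \<open>At the empty words the dilation identity equates the quadratic form of the iterated
  Cuntz map at \<open>W u\<close> with that of the shifted kernel at \<open>u\<close>; limits are
  unique.\<close>

lemma asymptotic_projection_cinner: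
  fixes S :: "'d::finite \<Rightarrow> 'k::chilbert_space \<Rightarrow> 'k"
  assumes dil: "cuntz_dilation K S W P P1" and P_inf: "asymptotic_projection S W P P_inf"
    and lim: "(\<lambda>N. cinner u ((free_shift ^^ N) K [] [] u)) \<longlonglongrightarrow> l"
  shows "cinner (W u) (P_inf (W u)) = l"
proof -
  have S: "\<And>i. bounded_clinear (S i)" and W: "bounded_clinear W" and K: "dilates K S W P"
    using dil by (auto simp: cuntz_dilation_def cuntz_family_def is_isometry_def)
  have "cinner (W u) ((cuntz_map S ^^ N) P (W u)) = cinner u ((free_shift ^^ N) K [] [] u)" for N
    using dilates_free_shift_funpow[OF K S W, of N]
    by (simp add: dilates_def word_op_Nil cadjoint_id cinner_cadjoint[OF W, symmetric])
  moreover have "(\<lambda>N. cinner (W u) ((cuntz_map S ^^ N) P (W u))) \<longlonglongrightarrow> cinner (W u) (P_inf (W u))"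
    using P_inf range_in_cyclic_subspace[of W u S]
    by (simp add: asymptotic_projection_def Let_def)
  ultimately show ?thesis
    using lim LIMSEQ_unique by fastforce
qed

text \<open>Expanding \<open>cadjoint W e\<close> in the finite basis \<open>E\<close> writes the
  operator as a finite sum of rank-one terms, and Parseval in the cyclic subspace evaluates the
  trace of each.\<close>

lemma trace_on_cyclic_subspace:
  fixes W :: "'h::chilbert_space \<Rightarrow> 'k::chilbert_space"
  assumes W: "bounded_clinear W" and P_inf: "asymptotic_projection S W P P_inf"
    and E: "finite E" "orthonormal_basis_on UNIV E"
  shows "trace_on (cyclic_subspace S W) (P_inf \<circ> W \<circ> cadjoint W) =
    (\<Sum>f\<in>E. cinner (W f) (P_inf (W f)))"
proof -
  define M where "M = cyclic_subspace S W"
  define B where "B = (SOME B. orthonormal_basis_on M B)"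
  have M: "complex_vector.subspace M" "closed M"
    unfolding M_def by (rule complex_subspace_cyclic_subspace) (simp add: cyclic_subspace_def)
  have B: "orthonormal_basis_on M B"
    unfolding B_def by (rule someI_ex[OF orthonormal_basis_exists[OF M]])
  have WM: "W u \<in> M" for u
    unfolding M_def by (rule range_in_cyclic_subspace)
  have P_inf_M: "x \<in> M \<Longrightarrow> P_inf x \<in> M"
    and P_inf_add: "x \<in> M \<Longrightarrow> y \<in> M \<Longrightarrow> P_inf (x + y) = P_inf x + P_inf y"
    and P_inf_scale: "x \<in> M \<Longrightarrow> P_inf (c *\<^sub>C x) = c *\<^sub>C P_inf x" for x y c
    using P_inf unfolding asymptotic_projection_def Let_def M_def by blast+
  have P_inf_0: "P_inf 0 = 0"
    using P_inf_scale[OF complex_vector.subspace_0[OF M(1)], of 0] by simp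
  \<comment> \<open>\<open>P_inf\<close> is linear only on \<open>M\<close>, so the induction must
    check that partial sums stay in \<open>M\<close>.\<close>
  have P_inf_sum: "P_inf (\<Sum>f\<in>F. c f *\<^sub>C W f) = (\<Sum>f\<in>F. c f *\<^sub>C P_inf (W f))"
    if "finite F" for F :: "'h set" and c
    using that
  proof (induction F)
    case (insert f F)
    have "(\<Sum>f\<in>F. c f *\<^sub>C W f) \<in> M" "c f *\<^sub>C W f \<in> M"
      by (intro complex_vector.subspace_sum complex_vector.subspace_scale M WM)+
    then show ?case using insert by (simp add: P_inf_add P_inf_scale WM)
  qed (simp add: P_inf_0)
  have "cinner e (P_inf (W (cadjoint W e))) = (\<Sum>f\<in>E. cinner (W f) e * cinner e (P_inf (W f)))" for e
  proof -
    have "cadjoint W e = (\<Sum>f\<in>E. cinner f (cadjoint W e) *\<^sub>C f)"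
      by (rule orthonormal_expansion[OF E, symmetric])
    then have "W (cadjoint W e) = W (\<Sum>f\<in>E. cinner (W f) e *\<^sub>C f)"
      unfolding cinner_cadjoint[OF W, symmetric] by simp
    also have "\<dots> = (\<Sum>f\<in>E. cinner (W f) e *\<^sub>C W f)"
      using W by (simp add: bounded_clinear_sum_apply) (simp add: bounded_clinear_def)
    finally show ?thesis
      by (simp add: P_inf_sum[OF E(1)] cinner.sum_right cinner_scaleC_right)
  qed
  \<comment> \<open>Parseval applies because \<open>P_inf (W f)\<close> lies in \<open>M\<close>;
    the sum over \<open>E\<close> is finite and may be taken outside.\<close>
  moreover have "((\<lambda>e. \<Sum>f\<in>E. cinner (W f) e * cinner e (P_inf (W f)))
      has_sum (\<Sum>f\<in>E. cinner (W f) (P_inf (W f)))) B"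
    by (intro has_sum_finite_sum E parseval_has_sum[OF B] P_inf_M WM)
  ultimately show ?thesis
    unfolding trace_on_def M_def[symmetric] B_def[symmetric] by (simp add: infsumI)
qed


section \<open>Curvature\<close>

theorem theorem6p2:
  fixes \<Omega> :: "'w measure"
    and A :: "'d::finite \<Rightarrow> 'w \<Rightarrow> 'h::chilbert_space \<Rightarrow> 'h"
    and K K_pure K_unitary :: "('d, 'h) kernel"
  assumes finite_dim: "\<exists>B :: 'h set. finite B \<and> complex_vector.span B = UNIV"
    and moment: "moment_kernel \<Omega> A K"
    and normalized: "K [] [] = id"
    and defect: "positive_definite (kernel_diff K (free_shift K))"
    and wold: "wold_decomposition K K_pure K_unitary"
  shows
    "(\<lambda>N. tr ((free_shift ^^ N) K [] [])) \<longlonglongrightarrow> complex_of_real (curvature K) \<and>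
     complex_of_real (curvature K) = tr (K_unitary [] []) \<and>
     curvature K = Sup {Re (tr (L [] [])) | L.
       positive_definite L \<and> kernel_le L K \<and> free_shift L = L} \<and>
     (\<forall>(S :: 'd \<Rightarrow> 'k::chilbert_space \<Rightarrow> 'k) W P P1 P_inf.
        minimal_cuntz_dilation K S W P P1 \<and> asymptotic_projection S W P P_inf \<longrightarrow>
        complex_of_real (curvature K) = tr (cadjoint W \<circ> P_inf \<circ> W) \<and>
        complex_of_real (curvature K) =
          trace_on (cyclic_subspace S W) (P_inf \<circ> W \<circ> cadjoint W)) \<and>
     (curvature K = 0 \<longleftrightarrow> K_unitary = zero_kernel) \<and>
     (K_unitary = zero_kernel \<longleftrightarrow> shift_tends_to_zero K) \<and>
     (curvature K = real (complex_vector.dim (UNIV :: 'h set)) \<longleftrightarrow> K_pure = zero_kernel)"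
proof -
  obtain E :: "'h set" where E: "finite E" "card E = complex_vector.dim (UNIV :: 'h set)"
    "orthonormal_basis_on UNIV E" and tr_eq: "\<And>A. tr A = (\<Sum>e\<in>E. cinner e (A e))"
    by (rule finite_dim_trace[OF finite_dim]) (rule that)
  have pure: "positive_definite K_pure" and unitary: "positive_definite K_unitary"
    and fixed: "free_shift K_unitary = K_unitary" and pure_lim: "shift_tends_to_zero K_pure"
    and K_sum: "\<And>\<alpha> \<beta> u. K \<alpha> \<beta> u = K_pure \<alpha> \<beta> u + K_unitary \<alpha> \<beta> u"
    using wold by (simp_all add: wold_decomposition_def)
  have K_pure_eq: "K_pure = kernel_diff K K_unitary"
    by (intro ext) (simp add: kernel_diff_def K_sum)
  have shift_lim: "(\<lambda>N. cinner u ((free_shift ^^ N) K \<alpha> \<beta> v)) \<longlonglongrightarrow> cinner u (K_unitary \<alpha> \<beta> v)"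
    for \<alpha> \<beta> u v
  proof (rule LIM_zero_cancel)
    \<comment> \<open>The shift is linear and fixes \<open>K_unitary\<close>, so shifting
      \<open>K_pure\<close> only moves the \<open>K\<close> term.\<close>
    have eq: "cinner u ((free_shift ^^ N) K_pure \<alpha> \<beta> v) =
        cinner u ((free_shift ^^ N) K \<alpha> \<beta> v) - cinner u (K_unitary \<alpha> \<beta> v)" for N
      unfolding K_pure_eq free_shift_funpow_kernel_diff funpow_fixed[of free_shift, OF fixed]
      by (simp add: kernel_diff_def cinner.diff_right)
    show "(\<lambda>N. cinner u ((free_shift ^^ N) K \<alpha> \<beta> v) - cinner u (K_unitary \<alpha> \<beta> v)) \<longlonglongrightarrow> 0"
      using pure_lim unfolding shift_tends_to_zero_def eq[symmetric] by blast
  qed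
  have tr_lim: "(\<lambda>N. tr ((free_shift ^^ N) K [] [])) \<longlonglongrightarrow> tr (K_unitary [] [])"
    unfolding tr_eq by (intro tendsto_sum shift_lim)
  have curvature_Re: "curvature K = Re (tr (K_unitary [] []))"
    unfolding curvature_def by (intro limI tendsto_Re tr_lim)
  \<comment> \<open>Diagonal entries of a positive definite kernel are real, so passing to real
    parts in \<open>curvature\<close> loses nothing.\<close>
  have "tr (K_unitary [] []) = complex_of_real (\<Sum>e\<in>E. Re (cinner e (K_unitary [] [] e)))"
    unfolding tr_eq of_real_sum by (intro sum.cong refl positive_definite_diagonal_real(1) unitary)
  then have curvature: "complex_of_real (curvature K) = tr (K_unitary [] [])"
    by (simp add: curvature_Re)
  have curvature_sum: "curvature K = (\<Sum>e\<in>E. Re (cinner e (K_unitary [] [] e)))"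
    by (simp add: curvature_Re tr_eq)

  \<comment> \<open>The supremum over shift-invariant minorants\<close>
  have sup: "curvature K = Sup {Re (tr (L [] [])) | L.
      positive_definite L \<and> kernel_le L K \<and> free_shift L = L}" (is "_ = Sup ?T")
  proof (rule cSup_eq_maximum[symmetric])
    have "kernel_le K_unitary K"
      using pure unfolding kernel_le_def K_pure_eq .
    then show "curvature K \<in> ?T"
      using unitary fixed curvature_Re by blast
  next
    fix x assume "x \<in> ?T"
    then obtain L where x: "x = Re (tr (L [] []))" and le: "kernel_le L K" and "free_shift L = L"
      by blast
    \<comment> \<open>Shifting the positive definite kernel \<open>K - L\<close> preserves
      positivity and leaves \<open>L\<close> unchanged.\<close>
    have "Re (cinner e (L [] [] e)) \<le> Re (cinner e ((free_shift ^^ N) K [] [] e))" for N e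
      using positive_definite_diagonal_real(2)[OF positive_definite_free_shift_funpow,
          OF le[unfolded kernel_le_def], of e N "[]"]
      unfolding free_shift_funpow_kernel_diff funpow_fixed[of free_shift, OF \<open>free_shift L = L\<close>]
      by (simp add: kernel_diff_def cinner.diff_right)
    then have "x \<le> Re (tr ((free_shift ^^ N) K [] []))" for N
      unfolding x tr_eq by (simp add: sum_mono)
    then show "x \<le> curvature K"
      unfolding curvature_Re by (intro LIMSEQ_le_const[OF tendsto_Re[OF tr_lim]]) blast
  qed

  \<comment> \<open>The two traces through the Cuntz dilation\<close>
  have dilation: "complex_of_real (curvature K) = tr (cadjoint W \<circ> P_inf \<circ> W) \<and>
      complex_of_real (curvature K) = trace_on (cyclic_subspace S W) (P_inf \<circ> W \<circ> cadjoint W)"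
    if "minimal_cuntz_dilation K S W P P1" "asymptotic_projection S W P P_inf"
    for S :: "'d \<Rightarrow> 'k \<Rightarrow> 'k" and W P P1 P_inf
  proof -
    have dil: "cuntz_dilation K S W P P1"
      using that by (simp add: minimal_cuntz_dilation_def)
    then have W: "bounded_clinear W"
      by (simp add: cuntz_dilation_def is_isometry_def)
    have "complex_of_real (curvature K) = (\<Sum>e\<in>E. cinner (W e) (P_inf (W e)))"
      unfolding curvature tr_eq
      by (intro sum.cong refl asymptotic_projection_cinner[OF dil that(2) shift_lim, symmetric])
    then show ?thesis
      by (simp add: tr_eq trace_on_cyclic_subspace[OF W that(2) E(1,3)] cinner_cadjoint[OF W])
  qed

  \<comment> \<open>Rigidity at the extreme values of the curvature\<close>
  have "curvature K = 0 \<longleftrightarrow> K_unitary = zero_kernel"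
  proof
    assume "curvature K = 0"
    then have "K_unitary [] [] u = 0" for u
      using curvature_sum by (intro positive_definite_trace_eq_0[OF unitary E(1,3)]) simp
    moreover have "kernel_diff K_unitary (free_shift K_unitary) = zero_kernel"
      unfolding fixed by (simp add: kernel_diff_def zero_kernel_def)
    ultimately show "K_unitary = zero_kernel"
      by (intro superharmonic_kernel_eq_zero[OF unitary])
        (simp_all add: positive_definite_zero cinner.zero_right)
  qed (simp add: curvature_sum zero_kernel_def cinner.zero_right)
  moreover have "K_unitary = zero_kernel \<longleftrightarrow> shift_tends_to_zero K"
  proof
    assume "K_unitary = zero_kernel"
    then show "shift_tends_to_zero K"
      using shift_lim by (simp add: shift_tends_to_zero_def zero_kernel_def cinner.zero_right)
  next
    assume "shift_tends_to_zero K"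
    then have "cinner u (K_unitary \<alpha> \<beta> v) = 0" for \<alpha> \<beta> u v
      using LIMSEQ_unique[OF shift_lim] by (simp add: shift_tends_to_zero_def)
    then show "K_unitary = zero_kernel"
      unfolding zero_kernel_def by (intro ext cinner_ext_right) (simp add: cinner.zero_right)
  qed
  moreover have "curvature K = real (complex_vector.dim (UNIV :: 'h set)) \<longleftrightarrow> K_pure = zero_kernel"
  proof -
    \<comment> \<open>The normalization splits each unit diagonal entry between the two Wold parts,
      so the curvature falls short of the dimension by the trace of the pure part.\<close>
    have "Re (cinner e (K_unitary [] [] e)) = 1 - Re (cinner e (K_pure [] [] e))" if "e \<in> E" for e
    proof -
      have "cinner e (K [] [] e) = 1"
        using E(3) that by (simp add: normalized orthonormal_basis_on_def)
      then show ?thesis by (simp add: K_sum cinner_add_right complex_eq_iff)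
    qed
    then have defect_sum:
      "curvature K = real (card E) - (\<Sum>e\<in>E. Re (cinner e (K_pure [] [] e)))"
      by (simp add: curvature_sum sum_subtractf)
    show ?thesis
    proof
      assume "curvature K = real (complex_vector.dim (UNIV :: 'h set))"
      then have "K_pure [] [] u = 0" for u
        using defect_sum E(2) by (intro positive_definite_trace_eq_0[OF pure E(1,3)]) simp
      \<comment> \<open>The invariant part cancels in the defect, so the assumed positivity
        transfers to \<open>K_pure\<close>.\<close>
      moreover have "kernel_diff K_pure (free_shift K_pure) = kernel_diff K (free_shift K)"
        unfolding K_pure_eq free_shift_kernel_diff fixed by (simp add: kernel_diff_def)
      ultimately show "K_pure = zero_kernel"
        using defect by (intro superharmonic_kernel_eq_zero[OF pure]) (simp_all add: cinner.zero_right)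
    qed (simp add: defect_sum E(2) zero_kernel_def cinner.zero_right)
  qed
  ultimately show ?thesis
    using tr_lim curvature sup dilation by (intro conjI allI impI) (simp_all, blast+)
qed

end
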